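(* Consider conditional inequalities $$(\bm c_1\cdot\bm h\ge0\ \wedge\cdots\wedge\ \bm c_k\cdot\bm h\ge0)\ \Rightarrow\ \bm c\cdot\bm h\ge0 .$$ If the antecedents have slack, i.e. the set $\{\bm c_1,\dots,\bm c_k\}$ has slack, and the set $\{\bm c,-\bm c_1,\dots,-\bm c_k\}$ is group balanced, then the corresponding decision problem (check whether the conditional inequality holds for all $\bm h\in\overline{\Gamma}_n^*$) is in $\Sigma^0_2$. That is, the problem restricted to inputs with these two properties is in $\Sigma^0_2$.
   Context: All logarithms are in base 2. A random variable $X$ with finite domain $D$ and probability mass function $p$ has entropy $H(X)=-\sum_{x\in D}p(x)\log p(x)$. Given a joint distribution of $n$ random variables $X_1,\dots,X_n$ with finite domains, its entropic vector is $\bm h=(h(\alpha))_{\alpha\subseteq[n]}\in\mathbb R_+^{2^n}$, where $h(\alpha)=H((X_i)_{i\in\alpha})$ and $h(\emptyset)=0$. $\Gamma_n^*$ denotes the set of all entropic vectors and $\overline{\Gamma}_n^*$ its topological closure, the set of almost-entropic vectors. For $\bm c,\bm h\in\mathbb R^{2^n}$, $\bm c\cdot\bm h=\sum_{\alpha\subseteq[n]}c_\alpha h(\alpha)$. The decision problem: given integer vectors $\bm c,\bm c_1,\dots,\bm c_k\in\mathbb Z^{2^n}$, check whether $(\bm c_1\cdot\bm h\ge0\wedge\cdots\wedge\bm c_k\cdot\bm h\ge0)\Rightarrow\bm c\cdot\bm h\ge0$ holds for all $\bm h\in\overline{\Gamma}_n^*$. The set $\{\bm c_1,\dots,\bm c_k\}$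 has slack if there exists a single $\bm h\in\overline{\Gamma}_n^*$ such that $\bm c_i\cdot\bm h>0$ for all $i=1,\dots,k$. A vector $\bm h\in\mathbb R^{2^n}$ (with $h(\emptyset)=0$) is modular if $h(\alpha)+h(\beta)=h(\alpha\cup\beta)+h(\alpha\cap\beta)$ for all $\alpha,\beta\subseteq[n]$. For $j\in[n]$ the basic modular function $\bm h^{(j)}$ is given by $h^{(j)}(\alpha)=1$ if $j\in\alpha$ and $h^{(j)}(\alpha)=0$ otherwise. A set $\{\bm d_1,\dots,\bm d_r\}\subseteq\mathbb R^{2^n}$ is group balanced if (a) $\mathrm{rank}(\bm A)=r-1$, where $\bm A$ is the $r\times n$ matrix with $A_{ij}=\bm d_i\cdot\bm h^{(j)}$, and (b) there exists a non-negative modular function $\bm h^{( * )}\ne0$ such that $\bm d_i\cdot\bm h^{( * )}=0$ for all $i$. Inputs are encoded as natural numbers. $\Sigma^0_2$ is the class of sets of the form $\{x\mid\exists y_1\forall y_2\,R(x,y_1,y_2)\}$ with $R$ a decidable predicate. A decision problem restricted to a class of inputs is in $\Sigma^0_2$ if there is a set in $\Sigma^0_2$ that contains an input of that class if and only if the answer to the problem on this input is yes. *)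

theory Defs
  imports
    "HOL-Library.Nat_Bijection"
    "HOL-Probability.Probability_Mass_Function"
    "HOL-Analysis.Function_Topology"
    "Jordan_Normal_Form.DL_Rank"
begin

(* The index set [n] is {..<n}.  A vector indexed by the subsets of [n] is a function on nat set
   of which only the values on Pow {..<n} matter. *)

definition dot :: "nat \<Rightarrow> (nat set \<Rightarrow> real) \<Rightarrow> (nat set \<Rightarrow> real) \<Rightarrow> real" where
  "dot n c h = (\<Sum>\<alpha>\<in>Pow {..<n}. c \<alpha> * h \<alpha>)"

definition real_vector :: "(nat set \<Rightarrow> int) \<Rightarrow> nat set \<Rightarrow> real" where
  "real_vector c = (\<lambda>\<alpha>. real_of_int (c \<alpha>))"

(* Outside set_pmf p the mass is 0, so summing over the support gives the same value as summing
   over any finite domain. *)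
definition shannon_entropy :: "'a pmf \<Rightarrow> real" where
  "shannon_entropy p = - (\<Sum>x\<in>set_pmf p. pmf p x * log 2 (pmf p x))"

(* p is the joint distribution of X_0, ..., X_{n-1}, with X_i the i-th coordinate; restrict x \<alpha>
   is the value of the sub-tuple of the X_i with i in \<alpha>. *)
definition entropic_vector :: "nat \<Rightarrow> (nat \<Rightarrow> nat) pmf \<Rightarrow> nat set \<Rightarrow> real" where
  "entropic_vector n p =
     (\<lambda>\<alpha>. if \<alpha> \<subseteq> {..<n} then shannon_entropy (map_pmf (\<lambda>x. restrict x \<alpha>) p) else 0)"

(* Entropy does not depend on how the values are named, so finite domains inside nat suffice. *)
definition entropic_vectors :: "nat \<Rightarrow> (nat set \<Rightarrow> real) set" where
  "entropic_vectors n =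
     {entropic_vector n p | p. \<exists>D. (\<forall>i<n. finite (D i)) \<and> set_pmf p \<subseteq> (\<Pi>\<^sub>E i\<in>{..<n}. D i)}"

(* Closure in the product topology on functions.  Entropic vectors vanish outside Pow {..<n}, so
   this is the Euclidean closure in the space of functions on Pow {..<n}. *)
definition almost_entropic_vectors :: "nat \<Rightarrow> (nat set \<Rightarrow> real) set" where
  "almost_entropic_vectors n = closure (entropic_vectors n)"

definition conditional_inequality_valid ::
    "nat \<Rightarrow> (nat set \<Rightarrow> real) list \<Rightarrow> (nat set \<Rightarrow> real) \<Rightarrow> bool" where
  "conditional_inequality_valid n cs c \<longleftrightarrow>
     (\<forall>h\<in>almost_entropic_vectors n. (\<forall>c'\<in>set cs. dot n c' h \<ge> 0) \<longrightarrow> dot n c h \<ge> 0)"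

definition has_slack :: "nat \<Rightarrow> (nat set \<Rightarrow> real) list \<Rightarrow> bool" where
  "has_slack n cs \<longleftrightarrow> (\<exists>h\<in>almost_entropic_vectors n. \<forall>c'\<in>set cs. dot n c' h > 0)"

definition modular :: "nat \<Rightarrow> (nat set \<Rightarrow> real) \<Rightarrow> bool" where
  "modular n h \<longleftrightarrow> h {} = 0 \<and>
     (\<forall>\<alpha> \<beta>. \<alpha> \<subseteq> {..<n} \<longrightarrow> \<beta> \<subseteq> {..<n} \<longrightarrow> h \<alpha> + h \<beta> = h (\<alpha> \<union> \<beta>) + h (\<alpha> \<inter> \<beta>))"

definition basic_modular :: "nat \<Rightarrow> nat set \<Rightarrow> real" where
  "basic_modular j = (\<lambda>\<alpha>. if j \<in> \<alpha> then 1 else 0)"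

(* The vectors are taken as a list d_1, ..., d_r (repetitions count towards r).
   vec_space.rank r is the rank of a real matrix with r rows. *)
definition group_balanced :: "nat \<Rightarrow> (nat set \<Rightarrow> real) list \<Rightarrow> bool" where
  "group_balanced n ds \<longleftrightarrow>
     vec_space.rank (length ds)
       (Matrix.mat (length ds) n (\<lambda>(i, j). dot n (ds ! i) (basic_modular j))) + 1 = length ds \<and>
     (\<exists>h. modular n h \<and> (\<forall>\<alpha>\<subseteq>{..<n}. h \<alpha> \<ge> 0) \<and> (\<exists>\<alpha>\<subseteq>{..<n}. h \<alpha> \<noteq> 0) \<and>
          (\<forall>d\<in>set ds. dot n d h = 0))"

(* General recursive functions of arity n, as functions on argument lists of which only the values
   on lists of length n matter (rule ext).  Minimisation is applied to regular functions only,
   which yields exactly the total computable functions. *)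
inductive recursive_function :: "nat \<Rightarrow> (nat list \<Rightarrow> nat) \<Rightarrow> bool" where
  zero: "recursive_function n (\<lambda>_. 0)"
| succ: "recursive_function 1 (\<lambda>xs. Suc (xs ! 0))"
| proj: "i < n \<Longrightarrow> recursive_function n (\<lambda>xs. xs ! i)"
| comp: "recursive_function (length gs) f \<Longrightarrow> (\<forall>g\<in>set gs. recursive_function n g) \<Longrightarrow>
    recursive_function n (\<lambda>xs. f (map (\<lambda>g. g xs) gs))"
| prim_rec: "recursive_function n f \<Longrightarrow> recursive_function (Suc (Suc n)) g \<Longrightarrow>
    recursive_function (Suc n)
      (\<lambda>xs. rec_nat (f (tl xs)) (\<lambda>y r. g (y # r # tl xs)) (hd xs))"
| minim: "recursive_function (Suc n) f \<Longrightarrow> (\<forall>xs. length xs = n \<longrightarrow> (\<exists>y. f (y # xs) = 0)) \<Longrightarrow>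
    recursive_function n (\<lambda>xs. LEAST y. f (y # xs) = 0)"
| ext: "recursive_function n f \<Longrightarrow> (\<forall>xs. length xs = n \<longrightarrow> f xs = g xs) \<Longrightarrow>
    recursive_function n g"

definition decidable3 :: "(nat \<Rightarrow> nat \<Rightarrow> nat \<Rightarrow> bool) \<Rightarrow> bool" where
  "decidable3 R \<longleftrightarrow>
     recursive_function 3 (\<lambda>xs. if R (xs ! 0) (xs ! 1) (xs ! 2) then 1 else 0)"

definition Sigma02 :: "nat set set" where
  "Sigma02 = {{x. \<exists>y1. \<forall>y2. R x y1 y2} | R. decidable3 R}"

(* Entry i of the coded list is the coordinate at the subset of [n] with characteristic bits i. *)
definition vector_code :: "nat \<Rightarrow> (nat set \<Rightarrow> int) \<Rightarrow> nat" where
  "vector_code n c = list_encode (map (\<lambda>i. int_encode (c (set_decode i))) [0..<2 ^ n])"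

definition input_code :: "nat \<Rightarrow> (nat set \<Rightarrow> int) list \<Rightarrow> (nat set \<Rightarrow> int) \<Rightarrow> nat" where
  "input_code n cs c = prod_encode (n, list_encode (map (vector_code n) (c # cs)))"

end

theory Submission imports Defs begin

text \<open>Slack makes invalidity an open condition: if \<open>h\<close> violates the conditional inequality and \<open>h0\<close>
  has all antecedents positive, then \<open>N * h + h0\<close> is almost entropic (entropic vectors are closed
  under addition, by taking independent copies) and for large \<open>N\<close> violates the inequality with all
  antecedents strictly positive. Hence it can be replaced by an entropic vector, and further by the
  entropic vector of a distribution with rational probabilities, i.e. of a uniformly chosen row of
  a finite table. For such a distribution the sign of \<open>c \<bullet> h\<close> is decided by comparing two
  products of powers of natural numbers. Validity is therefore co-recursively enumerable under
  slack, and in particular in \<open>\<Sigma>\<^sup>0\<^sub>2\<close>.\<close>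

subsection \<open>Closure properties of recursive functions\<close>

lemma rec_ext: "recursive_function n f \<Longrightarrow> (\<And>xs. length xs = n \<Longrightarrow> f xs = g xs) \<Longrightarrow> recursive_function n g"
  using recursive_function.ext by blast

text \<open>Composition with the projections to positions 1 to \<open>n\<close>. It serves terms
  below a sum, product or quantifier that do not mention the bound variable, which sits at the head
  of the list.\<close>

lemma rec_weaken:
  assumes "recursive_function n f"
  shows "recursive_function (Suc n) (\<lambda>ys. f (tl ys))"
proof -
  let ?gs = "map (\<lambda>i ys. ys ! Suc i) [0..<n]"
  have "recursive_function (Suc n) (\<lambda>ys. f (map (\<lambda>g. g ys) ?gs))"
    by (rule recursive_function.comp) (use assms in \<open>auto intro: recursive_function.proj\<close>)
  then show ?thesis
    by (rule rec_ext) (auto intro!: arg_cong[where f = f] nth_equalityI simp: nth_tl)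
qed

text \<open>\<open>prim_rec\<close> recurs on the head of the list; this supplies a computed
  recursion depth there.\<close>

lemma rec_insert:
  assumes "recursive_function (Suc n) f" "recursive_function n b"
  shows "recursive_function n (\<lambda>xs. f (b xs # xs))"
proof -
  let ?gs = "b # map (\<lambda>i ys. ys ! i) [0..<n]"
  have "recursive_function n (\<lambda>ys. f (map (\<lambda>g. g ys) ?gs))"
    by (rule recursive_function.comp) (use assms in \<open>auto intro: recursive_function.proj\<close>)
  then show ?thesis
    by (rule rec_ext) (auto intro!: arg_cong[where f = f] nth_equalityI)
qed

named_theorems rec_intros

text \<open>The rules for binders below present bound variables and parameters through chains of
  \<open>hd\<close> and \<open>tl\<close>; these are the corresponding projections for up to three
  nested binders.\<close>

lemma rec_nth [rec_intros]:
  "i < n \<Longrightarrow> recursive_function n (\<lambda>xs. xs ! i)"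
  "Suc i < n \<Longrightarrow> recursive_function n (\<lambda>xs. tl xs ! i)"
  "Suc (Suc i) < n \<Longrightarrow> recursive_function n (\<lambda>xs. tl (tl xs) ! i)"
  "Suc (Suc (Suc i)) < n \<Longrightarrow> recursive_function n (\<lambda>xs. tl (tl (tl xs)) ! i)"
  by (rule recursive_function.proj, assumption)
     (rule rec_ext[OF recursive_function.proj], assumption, simp add: nth_tl)+

lemma rec_hd [rec_intros]:
  "0 < n \<Longrightarrow> recursive_function n hd"
  "Suc 0 < n \<Longrightarrow> recursive_function n (\<lambda>xs. hd (tl xs))"
  "Suc (Suc 0) < n \<Longrightarrow> recursive_function n (\<lambda>xs. hd (tl (tl xs)))"
proof -
  show "recursive_function n hd" if "0 < n"
    by (rule rec_ext[OF recursive_function.proj[OF that]]) (use that in \<open>auto simp: hd_conv_nth\<close>)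
  show "recursive_function n (\<lambda>xs. hd (tl xs))" if "Suc 0 < n"
    by (rule rec_ext[OF recursive_function.proj[OF that]])
       (use that in \<open>auto simp: hd_conv_nth nth_tl simp flip: length_greater_0_conv\<close>)
  show "recursive_function n (\<lambda>xs. hd (tl (tl xs)))" if "Suc (Suc 0) < n"
    by (rule rec_ext[OF recursive_function.proj[OF that]])
       (use that in \<open>auto simp: hd_conv_nth nth_tl simp flip: length_greater_0_conv\<close>)
qed

lemma rec_Suc [rec_intros]:
  assumes "recursive_function n f"
  shows "recursive_function n (\<lambda>xs. Suc (f xs))"
proof -
  have "recursive_function n (\<lambda>xs. (\<lambda>ys. Suc (ys ! 0)) (map (\<lambda>g. g xs) [f]))"
    by (rule recursive_function.comp) (use assms recursive_function.succ in auto)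
  then show ?thesis by simp
qed

lemma rec_const [rec_intros]: "recursive_function n (\<lambda>_. k)"
  by (induction k) (auto intro: recursive_function.zero rec_Suc)

lemma rec_prim_rec [rec_intros]:
  assumes "recursive_function n b" "recursive_function n f"
    "recursive_function (Suc (Suc n)) (\<lambda>ys. g (hd ys) (hd (tl ys)) (tl (tl ys)))"
  shows "recursive_function n (\<lambda>xs. rec_nat (f xs) (\<lambda>y r. g y r xs) (b xs))"
  using rec_insert[OF recursive_function.prim_rec[OF assms(2,3)] assms(1)] by simp

lemma rec_add [rec_intros]:
  assumes "recursive_function n f" "recursive_function n g"
  shows "recursive_function n (\<lambda>xs. f xs + g xs)"
proof -
  have *: "rec_nat a (\<lambda>_ r. Suc r) b = a + b" for a b :: nat by (induction b) auto
  have "recursive_function n (\<lambda>xs. rec_nat (f xs) (\<lambda>_ r. Suc r) (g xs))"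
    by (intro assms rec_intros) auto
  then show ?thesis unfolding * .
qed

text \<open>The step of a primitive recursion sees counter, accumulator and parameters. A summand or
  factor depends on counter and parameters only, so the accumulator in second position is projected
  away.\<close>

lemma rec_skip:
  assumes "recursive_function (Suc n) (\<lambda>ys. g (hd ys) (tl ys))"
  shows "recursive_function (Suc (Suc n)) (\<lambda>ys. g (hd ys) (tl (tl ys)))"
proof -
  let ?gs = "hd # map (\<lambda>i ys. tl (tl ys) ! i) [0..<n]"
  have "recursive_function (Suc (Suc n)) (\<lambda>ys. (\<lambda>zs. g (hd zs) (tl zs)) (map (\<lambda>g. g ys) ?gs))"
    by (rule recursive_function.comp) (use assms in \<open>auto intro!: rec_intros\<close>)
  then show ?thesis
    by (rule rec_ext) (auto intro!: arg_cong[where f = "g _"] nth_equalityI)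
qed

lemma rec_sum [rec_intros]:
  assumes "recursive_function n b" "recursive_function (Suc n) (\<lambda>ys. g (hd ys) (tl ys))"
  shows "recursive_function n (\<lambda>xs. \<Sum>i<b xs. g i xs)"
proof -
  have *: "rec_nat 0 (\<lambda>y r. r + g y xs) k = (\<Sum>i<k. g i xs)" for k xs by (induction k) auto
  have "recursive_function n (\<lambda>xs. rec_nat 0 (\<lambda>y r. r + g y xs) (b xs))"
    by (intro assms rec_intros rec_skip[OF assms(2)]) auto
  then show ?thesis unfolding * .
qed

lemma rec_mult [rec_intros]:
  assumes "recursive_function n f" "recursive_function n g"
  shows "recursive_function n (\<lambda>xs. f xs * g xs)"
proof -
  have "recursive_function n (\<lambda>xs. \<Sum>i<f xs. g xs)"
    by (intro assms rec_intros rec_weaken)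
  then show ?thesis by simp
qed

lemma rec_prod [rec_intros]:
  assumes "recursive_function n b" "recursive_function (Suc n) (\<lambda>ys. g (hd ys) (tl ys))"
  shows "recursive_function n (\<lambda>xs. \<Prod>i<b xs. g i xs)"
proof -
  have *: "rec_nat 1 (\<lambda>y r. r * g y xs) k = (\<Prod>i<k. g i xs)" for k xs by (induction k) auto
  have "recursive_function n (\<lambda>xs. rec_nat 1 (\<lambda>y r. r * g y xs) (b xs))"
    by (intro assms rec_intros rec_skip[OF assms(2)]) auto
  then show ?thesis unfolding * .
qed

lemma rec_power [rec_intros]:
  assumes "recursive_function n f" "recursive_function n g"
  shows "recursive_function n (\<lambda>xs. f xs ^ g xs)"
proof -
  have "recursive_function n (\<lambda>xs. \<Prod>i<g xs. f xs)"
    by (intro assms rec_intros rec_weaken)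
  then show ?thesis by simp
qed

lemma rec_diff [rec_intros]:
  assumes "recursive_function n f" "recursive_function n g"
  shows "recursive_function n (\<lambda>xs. f xs - g xs)"
proof -
  \<comment> \<open>Predecessor by primitive recursion; truncated subtraction is its
    iteration.\<close>
  have *: "rec_nat 0 (\<lambda>y _. y) k = k - 1" for k by (cases k) auto
  have **: "rec_nat a (\<lambda>_ r. rec_nat 0 (\<lambda>y _. y) r) b = a - b" for a b :: nat
    by (induction b) (auto simp: *)
  have "recursive_function n (\<lambda>xs. rec_nat (f xs) (\<lambda>_ r. rec_nat 0 (\<lambda>y _. y) r) (g xs))"
    by (intro assms rec_intros) auto
  then show ?thesis unfolding ** .
qed

lemma rec_if_less:
  assumes "recursive_function n f" "recursive_function n g"
  shows "recursive_function n (\<lambda>xs. if f xs < g xs then 1 else 0)"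
proof -
  \<comment> \<open>With truncated subtraction, \<open>b - a\<close> is positive exactly if
    \<open>a < b\<close>, and \<open>1 - (1 - k)\<close> is the sign of \<open>k\<close>.\<close>
  have *: "(if a < b then 1 else 0) = 1 - (1 - (b - a))" for a b :: nat by auto
  show ?thesis unfolding * by (intro assms rec_intros)
qed

text \<open>The 0/1 characteristic function used in \<open>decidable3\<close>, for every
  arity.\<close>

definition rec_pred :: "nat \<Rightarrow> (nat list \<Rightarrow> bool) \<Rightarrow> bool" where
  "rec_pred n P \<longleftrightarrow> recursive_function n (\<lambda>xs. if P xs then 1 else 0)"

lemma rec_pred_less [rec_intros]:
  "recursive_function n f \<Longrightarrow> recursive_function n g \<Longrightarrow> rec_pred n (\<lambda>xs. f xs < g xs)"
  unfolding rec_pred_def by (rule rec_if_less)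

lemma rec_pred_not [rec_intros]:
  assumes "rec_pred n P" shows "rec_pred n (\<lambda>xs. \<not> P xs)"
proof -
  have *: "(if \<not> Q then 1 else 0) = 1 - (if Q then 1 else (0::nat))" for Q by auto
  show ?thesis using assms unfolding rec_pred_def * by (intro rec_intros)
qed

lemma rec_pred_conj [rec_intros]:
  assumes "rec_pred n P" "rec_pred n Q" shows "rec_pred n (\<lambda>xs. P xs \<and> Q xs)"
proof -
  have *: "(if A \<and> B then 1 else 0) = (if A then 1 else 0) * (if B then 1 else (0::nat))" for A B by auto
  show ?thesis using assms unfolding rec_pred_def * by (intro rec_intros)
qed

lemma rec_pred_imp [rec_intros]:
  assumes "rec_pred n P" "rec_pred n Q" shows "rec_pred n (\<lambda>xs. P xs \<longrightarrow> Q xs)"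
proof -
  have *: "(A \<longrightarrow> B) = (\<not> (A \<and> \<not> B))" for A B by auto
  show ?thesis using assms unfolding * by (intro rec_intros)
qed

lemma rec_pred_eq [rec_intros]:
  fixes f g :: "nat list \<Rightarrow> nat"
  assumes "recursive_function n f" "recursive_function n g"
  shows "rec_pred n (\<lambda>xs. f xs = g xs)"
proof -
  have *: "a = b \<longleftrightarrow> \<not> a < b \<and> \<not> b < a" for a b :: nat by auto
  show ?thesis unfolding * by (intro assms rec_intros)
qed

lemma rec_pred_all [rec_intros]:
  assumes "recursive_function n b" "rec_pred (Suc n) (\<lambda>ys. P (hd ys) (tl ys))"
  shows "rec_pred n (\<lambda>xs. \<forall>i<b xs. P i xs)"
proof -
  have *: "(if \<forall>i<b. Q i then 1 else 0) = (\<Prod>i<b. if Q i then 1 else (0::nat))" for Q and b :: nat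
    by auto
  show ?thesis using assms unfolding rec_pred_def * by (intro rec_intros)
qed

lemma rec_if [rec_intros]:
  assumes "rec_pred n P" "recursive_function n f" "recursive_function n g"
  shows "recursive_function n (\<lambda>xs. if P xs then f xs else g xs)"
proof -
  have *: "(if A then a else b) = (if A then 1 else 0) * a + (1 - (if A then 1 else 0)) * b" for A and a b :: nat
    by auto
  show ?thesis using assms unfolding rec_pred_def by (subst *) (intro rec_intros)
qed

lemma rec_div [rec_intros]:
  assumes "recursive_function n f" "recursive_function n g"
  shows "recursive_function n (\<lambda>xs. f xs div g xs)"
proof -
  \<comment> \<open>For \<open>b > 0\<close> the quotient counts the \<open>i < a\<close> with
    \<open>Suc i * b \<le> a\<close>. For \<open>b = 0\<close> every \<open>i\<close> would count,
    hence the separate value 0.\<close>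
  have *: "a div b = (if b = 0 then 0 else \<Sum>i<a. if a < Suc i * b then 0 else 1)" for a b :: nat
  proof (cases "b = 0")
    case False
    have "Suc i \<le> a div b \<longleftrightarrow> Suc i * b \<le> a" for i
      using False by (intro less_eq_div_iff_mult_less_eq) simp
    then have "i < a \<and> \<not> a < Suc i * b \<longleftrightarrow> i < a div b" for i
      using div_le_dividend[of a b] by (metis Suc_le_eq not_less order_less_le_trans)
    then have "{i. i < a \<and> \<not> a < Suc i * b} = {..<a div b}"
      by (simp add: lessThan_def)
    moreover have "(\<Sum>i<a. if a < Suc i * b then 0 else 1) = card {i. i < a \<and> \<not> a < Suc i * b}"
      unfolding card_eq_sum by (rule sum.mono_neutral_cong_right) auto
    ultimately show ?thesis using False by (metis card_lessThan)
  qed auto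
  show ?thesis
    by (subst *) (intro assms rec_intros rec_weaken[of _ f] rec_weaken[of _ g]; simp)
qed

lemma rec_pred_odd [rec_intros]:
  assumes "recursive_function n f" shows "rec_pred n (\<lambda>xs. odd (f xs))"
proof -
  have *: "odd a \<longleftrightarrow> \<not> a = 2 * (a div 2)" for a :: nat by presburger
  show ?thesis unfolding * by (intro assms rec_intros)
qed

section \<open>Codes of pairs and lists\<close>

lemma rec_prod_encode [rec_intros]:
  assumes "recursive_function n f" "recursive_function n g"
  shows "recursive_function n (\<lambda>xs. prod_encode (f xs, g xs))"
  unfolding prod_encode_def triangle_def prod.case by (intro assms rec_intros)

lemma rec_prod_decode [rec_intros]:
  assumes "recursive_function n f"
  shows "recursive_function n (\<lambda>xs. fst (prod_decode (f xs)))"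
    "recursive_function n (\<lambda>xs. snd (prod_decode (f xs)))"
proof -
  \<comment> \<open>Decoding by bounded search: both components are at most the code, and by
    injectivity only the term at the decoded pair is nonzero.\<close>
  have *: "(\<Sum>a<Suc z. \<Sum>b<Suc z. if prod_encode (a, b) = z then h a b else 0) =
      case_prod h (prod_decode z)" for z :: nat and h :: "nat \<Rightarrow> nat \<Rightarrow> nat"
  proof -
    obtain u v where uv: "prod_decode z = (u, v)" by fastforce
    then have z: "z = prod_encode (u, v)" by (metis prod_decode_inverse)
    have le: "u \<in> {..<Suc z}" "v \<in> {..<Suc z}"
      using le_prod_encode_1[of u v] le_prod_encode_2[of v u] unfolding z by auto
    have eq: "prod_encode (a, b) = z \<longleftrightarrow> a = u \<and> b = v" for a b
      unfolding z using inj_prod_encode by (auto dest: injD)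
    have "(\<Sum>a<Suc z. \<Sum>b<Suc z. if prod_encode (a, b) = z then h a b else 0) =
        (\<Sum>a<Suc z. if a = u then (\<Sum>b<Suc z. if b = v then h u v else 0) else 0)"
      unfolding eq by (intro sum.cong refl) auto
    also have "\<dots> = h u v" using le by (simp del: sum.lessThan_Suc)
    finally show ?thesis using uv by simp
  qed
  have "recursive_function n (\<lambda>xs. \<Sum>a<Suc (f xs). \<Sum>b<Suc (f xs). if prod_encode (a, b) = f xs then a else 0)"
    "recursive_function n (\<lambda>xs. \<Sum>a<Suc (f xs). \<Sum>b<Suc (f xs). if prod_encode (a, b) = f xs then b else 0)"
    by (intro assms rec_intros rec_weaken[of _ "\<lambda>xs. f (tl xs)"] rec_weaken[of _ f]; simp)+
  then show "recursive_function n (\<lambda>xs. fst (prod_decode (f xs)))"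
    "recursive_function n (\<lambda>xs. snd (prod_decode (f xs)))"
    unfolding * by (simp_all add: case_prod_beta)
qed

text \<open>On codes by \<^const>\<open>list_encode\<close>. Since \<open>code_tl 0 = 0\<close>, dropping past the end of a list
  yields the code of the empty list.\<close>

definition code_tl :: "nat \<Rightarrow> nat" where "code_tl z = snd (prod_decode (z - 1))"

definition code_drop :: "nat \<Rightarrow> nat \<Rightarrow> nat" where "code_drop z i = (code_tl ^^ i) z"

definition code_nth :: "nat \<Rightarrow> nat \<Rightarrow> nat" where
  "code_nth z i = fst (prod_decode (code_drop z i - 1))"

lemma rec_code_drop [rec_intros]:
  assumes "recursive_function n f" "recursive_function n g"
  shows "recursive_function n (\<lambda>xs. code_drop (f xs) (g xs))"
proof -
  have *: "rec_nat z (\<lambda>_ r. snd (prod_decode (r - 1))) i = code_drop z i" for z i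
    by (induction i) (auto simp: code_drop_def code_tl_def)
  have "recursive_function n (\<lambda>xs. rec_nat (f xs) (\<lambda>_ r. snd (prod_decode (r - 1))) (g xs))"
    by (intro assms rec_intros) auto
  then show ?thesis unfolding * .
qed

lemma rec_code_nth [rec_intros]:
  assumes "recursive_function n f" "recursive_function n g"
  shows "recursive_function n (\<lambda>xs. code_nth (f xs) (g xs))"
  unfolding code_nth_def by (intro assms rec_intros)

lemma code_tl_0: "code_tl 0 = 0"
proof -
  have "prod_decode 0 = (0, 0)"
    using prod_encode_inverse[of "(0,0)"] by (simp add: prod_encode_def)
  then show ?thesis by (simp add: code_tl_def)
qed

lemma code_drop_list_encode: "code_drop (list_encode xs) i = list_encode (drop i xs)"
proof (induction i arbitrary: xs)
  case (Suc i)
  have "code_drop (list_encode xs) (Suc i) = code_drop (code_tl (list_encode xs)) i"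
    by (simp add: code_drop_def funpow_swap1)
  also have "code_tl (list_encode xs) = list_encode (tl xs)"
    by (cases xs) (auto simp: code_tl_0, simp add: code_tl_def)
  finally show ?case using Suc by (simp add: drop_Suc)
qed (simp add: code_drop_def)

lemma code_nth_list_encode: "i < length xs \<Longrightarrow> code_nth (list_encode xs) i = xs ! i"
  by (simp add: code_nth_def code_drop_list_encode Cons_nth_drop_Suc[symmetric])

text \<open>Only the empty list has code 0. This is how \<open>refutes\<close> recognises the end of
  the list of vectors.\<close>

lemma code_drop_list_encode_eq_0_iff: "code_drop (list_encode xs) i = 0 \<longleftrightarrow> length xs \<le> i"
  unfolding code_drop_list_encode
  using drop_eq_Nil[of i xs] by (cases "drop i xs") (simp_all del: drop_eq_Nil)

text \<open>The code can therefore serve as the bound of a quantifier over list positions.\<close>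

lemma length_le_list_encode: "length xs \<le> list_encode xs"
proof (induction xs)
  case (Cons x xs)
  then show ?case using le_prod_encode_2[of "list_encode xs" x] by simp
qed simp

subsection \<open>Entropic vectors\<close>

text \<open>Points of mass 0 contribute 0. This gives a whole sequence of distributions one common
  range of summation when limits are taken.\<close>

lemma shannon_entropy_superset:
  assumes "finite S" "set_pmf p \<subseteq> S"
  shows "shannon_entropy p = - (\<Sum>x\<in>S. pmf p x * log 2 (pmf p x))"
  unfolding shannon_entropy_def
  by (intro arg_cong[where f = uminus] sum.mono_neutral_left) (use assms in \<open>auto simp: set_pmf_iff\<close>)

lemma shannon_entropy_map_inj:
  assumes "inj_on f (set_pmf p)"
  shows "shannon_entropy (map_pmf f p) = shannon_entropy p"
  using assms by (simp add: shannon_entropy_def sum.reindex pmf_map_inj cong: sum.cong)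

text \<open>The logarithm splits the product mass, and the masses of each factor sum to 1.\<close>

lemma shannon_entropy_pair:
  assumes "finite (set_pmf p)" "finite (set_pmf q)"
  shows "shannon_entropy (pair_pmf p q) = shannon_entropy p + shannon_entropy q"
proof -
  have "(\<Sum>z\<in>set_pmf (pair_pmf p q). pmf (pair_pmf p q) z * log 2 (pmf (pair_pmf p q) z)) =
      (\<Sum>x\<in>set_pmf p. \<Sum>y\<in>set_pmf q. pmf p x * pmf q y * log 2 (pmf p x * pmf q y))"
    by (simp add: sum.cartesian_product pmf_pair case_prod_beta flip: pmf_pair)
  also have "\<dots> = (\<Sum>x\<in>set_pmf p. \<Sum>y\<in>set_pmf q.
      pmf p x * log 2 (pmf p x) * pmf q y + pmf p x * (pmf q y * log 2 (pmf q y)))"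
    by (intro sum.cong refl) (simp add: log_mult pmf_positive set_pmf_iff algebra_simps)
  also have "\<dots> = (\<Sum>x\<in>set_pmf p. pmf p x * log 2 (pmf p x)) * (\<Sum>y\<in>set_pmf q. pmf q y) +
      (\<Sum>x\<in>set_pmf p. pmf p x) * (\<Sum>y\<in>set_pmf q. pmf q y * log 2 (pmf q y))"
    by (simp add: sum.distrib sum_product)
  finally show ?thesis
    using assms by (simp add: shannon_entropy_def sum_pmf_eq_1)
qed

section \<open>Closure under addition\<close>

lemma entropic_vectors_add:
  assumes "h1 \<in> entropic_vectors n" "h2 \<in> entropic_vectors n"
  shows "(\<lambda>\<alpha>. h1 \<alpha> + h2 \<alpha>) \<in> entropic_vectors n"
proof -
  obtain p D where p: "h1 = entropic_vector n p" "\<forall>i<n. finite (D i)" "set_pmf p \<subseteq> (\<Pi>\<^sub>E i\<in>{..<n}. D i)"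
    using assms(1) unfolding entropic_vectors_def by blast
  obtain q E where q: "h2 = entropic_vector n q" "\<forall>i<n. finite (E i)" "set_pmf q \<subseteq> (\<Pi>\<^sub>E i\<in>{..<n}. E i)"
    using assms(2) unfolding entropic_vectors_def by blast
  have fin: "finite (set_pmf p)" "finite (set_pmf q)"
    by (rule finite_subset[OF p(3) finite_PiE], use p(2) in simp, use p(2) in simp)
      (rule finite_subset[OF q(3) finite_PiE], use q(2) in simp, use q(2) in simp)
  \<comment> \<open>\<open>G\<close> merges two tuples coordinatewise into coded pairs, so that the
    restriction of \<open>r\<close> to \<alpha> is a function of the two independent
    restrictions.\<close>
  define G :: "nat set \<Rightarrow> (nat \<Rightarrow> nat) \<times> (nat \<Rightarrow> nat) \<Rightarrow> nat \<Rightarrow> nat"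
    where "G = (\<lambda>\<alpha> (x, y). \<lambda>i\<in>\<alpha>. prod_encode (x i, y i))"
  define r where "r = map_pmf (G {..<n}) (pair_pmf p q)"
  have "entropic_vector n r \<alpha> = h1 \<alpha> + h2 \<alpha>" for \<alpha>
  proof (cases "\<alpha> \<subseteq> {..<n}")
    case True
    let ?p = "map_pmf (\<lambda>x. restrict x \<alpha>) p" and ?q = "map_pmf (\<lambda>x. restrict x \<alpha>) q"
    have "restrict (G {..<n} z) \<alpha> = G \<alpha> (case z of (x, y) \<Rightarrow> (restrict x \<alpha>, restrict y \<alpha>))" for z
      using True by (auto simp: G_def restrict_def fun_eq_iff split: prod.splits)
    then have "map_pmf (\<lambda>x. restrict x \<alpha>) r = map_pmf (G \<alpha>) (pair_pmf ?p ?q)"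
      unfolding map_pair[symmetric] r_def map_pmf_comp by simp
    \<comment> \<open>Injectivity needs tuples that are fixed outside \<alpha>, since
      \<open>G \<alpha>\<close> forgets those values; restrictions are of this kind.\<close>
    moreover have "inj_on (G \<alpha>) (set_pmf (pair_pmf ?p ?q))"
    proof (rule inj_on_subset)
      show "inj_on (G \<alpha>) (extensional \<alpha> \<times> extensional \<alpha>)"
      proof (rule inj_onI, clarsimp simp: G_def)
        fix x y x' y' assume ext: "x \<in> extensional \<alpha>" "y \<in> extensional \<alpha>"
          "x' \<in> extensional \<alpha>" "y' \<in> extensional \<alpha>"
          and eq: "(\<lambda>i\<in>\<alpha>. prod_encode (x i, y i)) = (\<lambda>i\<in>\<alpha>. prod_encode (x' i, y' i))"
        have "x i = x' i \<and> y i = y' i" if "i \<in> \<alpha>" for i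
          using fun_cong[OF eq, of i] that by simp
        then show "x = x' \<and> y = y'"
          using ext by (auto intro: extensionalityI)
      qed
    qed auto
    ultimately have "shannon_entropy (map_pmf (\<lambda>x. restrict x \<alpha>) r) = shannon_entropy (pair_pmf ?p ?q)"
      by (simp add: shannon_entropy_map_inj)
    also have "\<dots> = shannon_entropy ?p + shannon_entropy ?q"
      using fin by (intro shannon_entropy_pair) auto
    finally show ?thesis using True by (simp add: entropic_vector_def p q)
  qed (simp add: entropic_vector_def p q)
  moreover have "set_pmf r \<subseteq> (\<Pi>\<^sub>E i\<in>{..<n}. prod_encode ` (D i \<times> E i))"
    using p(3) q(3) by (force simp: r_def G_def PiE_iff subset_iff)
  moreover have "\<forall>i<n. finite (prod_encode ` (D i \<times> E i))"
    using p q by auto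
  ultimately show ?thesis
    unfolding entropic_vectors_def mem_Collect_eq
    by (intro exI[of _ r] conjI exI[of _ "\<lambda>i. prod_encode ` (D i \<times> E i)"]) (simp_all add: fun_eq_iff)
qed

text \<open>Addition is continuous and maps pairs of entropic vectors to entropic vectors; the
  closure of the product is the product of the closures.\<close>

lemma almost_entropic_vectors_add:
  assumes "h1 \<in> almost_entropic_vectors n" "h2 \<in> almost_entropic_vectors n"
  shows "(\<lambda>\<alpha>. h1 \<alpha> + h2 \<alpha>) \<in> almost_entropic_vectors n"
proof -
  let ?S = "entropic_vectors n" and ?f = "\<lambda>(h1, h2) (\<alpha> :: nat set). (h1 \<alpha> + h2 \<alpha> :: real)"
  have coord: "continuous_on UNIV (\<lambda>h :: nat set \<Rightarrow> real. h \<alpha>)" for \<alpha>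
    by (rule continuous_on_product_coordinates)
  have "continuous_on UNIV (\<lambda>z. ?f z \<alpha>)" for \<alpha> :: "nat set"
    unfolding case_prod_beta
    using continuous_on_compose2[OF coord[of \<alpha>] continuous_on_fst[OF continuous_on_id]]
      continuous_on_compose2[OF coord[of \<alpha>] continuous_on_snd[OF continuous_on_id]]
    by (intro continuous_on_add) auto
  then have "continuous_on UNIV ?f"
    by (rule continuous_on_coordinatewise_then_product)
  moreover have "?f ` (?S \<times> ?S) \<subseteq> closure ?S"
    using entropic_vectors_add closure_subset[of ?S] by fast
  ultimately have "?f ` closure (?S \<times> ?S) \<subseteq> closure ?S"
    by (intro image_closure_subset closed_closure) (rule continuous_on_subset, auto)
  moreover have "(h1, h2) \<in> closure (?S \<times> ?S)"
    using assms by (simp add: almost_entropic_vectors_def closure_Times)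
  ultimately have "?f (h1, h2) \<in> closure ?S" by (rule subsetD[OF _ imageI])
  then show ?thesis by (simp add: almost_entropic_vectors_def)
qed

lemma almost_entropic_vectors_mult_add:
  assumes "h1 \<in> almost_entropic_vectors n" "h2 \<in> almost_entropic_vectors n"
  shows "(\<lambda>\<alpha>. real N * h1 \<alpha> + h2 \<alpha>) \<in> almost_entropic_vectors n"
proof (induction N)
  case (Suc N)
  from almost_entropic_vectors_add[OF assms(1) Suc] show ?case
    by (simp add: algebra_simps)
qed (use assms in simp)

section \<open>Slack turns counterexamples into an open condition\<close>

lemma dot_mult_add: "dot n c (\<lambda>\<alpha>. r * h1 \<alpha> + h2 \<alpha>) = r * dot n c h1 + dot n c h2"
  by (simp add: dot_def sum.distrib sum_distrib_left algebra_simps)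

lemma continuous_on_dot: "continuous_on UNIV (dot n c)"
  unfolding dot_def by (intro continuous_intros continuous_on_product_coordinates)

lemma not_valid_iff_entropic:
  assumes "has_slack n cs"
  shows "\<not> conditional_inequality_valid n cs c \<longleftrightarrow>
    (\<exists>h\<in>entropic_vectors n. (\<forall>c'\<in>set cs. dot n c' h > 0) \<and> dot n c h < 0)"
proof
  assume "\<not> conditional_inequality_valid n cs c"
  then obtain h where h: "h \<in> almost_entropic_vectors n" "\<And>c'. c' \<in> set cs \<Longrightarrow> dot n c' h \<ge> 0" "dot n c h < 0"
    by (auto simp: conditional_inequality_valid_def not_le)
  obtain h0 where h0: "h0 \<in> almost_entropic_vectors n" "\<And>c'. c' \<in> set cs \<Longrightarrow> dot n c' h0 > 0"
    using assms by (auto simp: has_slack_def)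
  \<comment> \<open>This \<open>N\<close> makes the negative \<open>N * dot n c h\<close> outweigh
    \<open>dot n c h0\<close>, whatever the sign of the latter.\<close>
  obtain N where N: "dot n c h0 < real N * (- dot n c h)"
    using h(3) reals_Archimedean3[of "- dot n c h"] by auto
  define g where "g = (\<lambda>\<alpha>. real N * h \<alpha> + h0 \<alpha>)"
  \<comment> \<open>Finitely many strict inequalities between continuous functions, hence an open
    set; as it meets the closure at \<open>g\<close>, it contains an entropic vector.\<close>
  let ?U = "(\<Inter>c'\<in>set cs. {h. 0 < dot n c' h}) \<inter> {h. dot n c h < 0}"
  have "g \<in> ?U"
    using h h0 N by (auto simp: g_def dot_mult_add intro!: add_nonneg_pos)
  moreover have "g \<in> closure (entropic_vectors n)"
    using almost_entropic_vectors_mult_add[OF h(1) h0(1)] by (simp add: g_def almost_entropic_vectors_def)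
  moreover have "open ?U"
    by (intro open_Int open_INT finite_set ballI open_Collect_less continuous_on_const continuous_on_dot)
  ultimately have "?U \<inter> entropic_vectors n \<noteq> {}"
    using open_Int_closure_eq_empty by blast
  then show "\<exists>h\<in>entropic_vectors n. (\<forall>c'\<in>set cs. dot n c' h > 0) \<and> dot n c h < 0"
    by auto
next
  assume "\<exists>h\<in>entropic_vectors n. (\<forall>c'\<in>set cs. dot n c' h > 0) \<and> dot n c h < 0"
  then obtain h where "h \<in> almost_entropic_vectors n" "\<forall>c'\<in>set cs. dot n c' h > 0" "dot n c h < 0"
    unfolding almost_entropic_vectors_def using closure_subset by blast
  then show "\<not> conditional_inequality_valid n cs c"
    unfolding conditional_inequality_valid_def by (meson less_le_not_le order_less_imp_le)
qed

section \<open>Uniform distributions on finite tables and their density\<close>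

lemma pmf_map_table:
  assumes "N > 0"
  shows "pmf (map_pmf X (pmf_of_set {..<N::nat})) z = card {i. i < N \<and> X i = z} / N"
proof -
  have "{..<N} \<inter> X -` {z} = {i. i < N \<and> X i = z}" by auto
  then show ?thesis using assms by (simp add: pmf_map measure_pmf_of_set lessThan_empty_iff)
qed

text \<open>Summing log-masses over rows rather than values counts a value \<open>z\<close> exactly
  \<open>N * p(z)\<close> times. Only logarithms of natural numbers remain.\<close>

lemma shannon_entropy_table:
  fixes X :: "nat \<Rightarrow> 'a"
  assumes "N > 0"
  shows "N * shannon_entropy (map_pmf X (pmf_of_set {..<N})) =
    N * log 2 N - (\<Sum>i<N. log 2 (card {k. k < N \<and> X k = X i}))"
proof -
  let ?P = "map_pmf X (pmf_of_set {..<N})"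
  let ?c = "\<lambda>z. card {k. k < N \<and> X k = z}"
  have pos: "0 < ?c (X i)" if "i < N" for i
    using that by (auto simp: card_gt_0_iff)
  have "(\<Sum>i<N. log 2 (pmf ?P (X i))) = (\<Sum>z\<in>X ` {..<N}. \<Sum>i\<in>{i\<in>{..<N}. X i = z}. log 2 (pmf ?P (X i)))"
    by (rule sum.image_gen) simp
  also have "\<dots> = (\<Sum>z\<in>X ` {..<N}. N * (pmf ?P z * log 2 (pmf ?P z)))"
    using assms by (intro sum.cong refl) (simp add: pmf_map_table)
  also have "\<dots> = - (N * shannon_entropy ?P)"
    using assms by (simp add: shannon_entropy_def sum_distrib_left lessThan_empty_iff)
  finally have "N * shannon_entropy ?P = - (\<Sum>i<N. log 2 (pmf ?P (X i)))" by simp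
  also have "\<dots> = - (\<Sum>i<N. log 2 (?c (X i)) - log 2 N)"
    using assms pos
    by (intro arg_cong[where f = uminus] sum.cong refl) (simp only: pmf_map_table lessThan_iff log_divide_pos of_nat_0_less_iff)
  also have "\<dots> = N * log 2 N - (\<Sum>i<N. log 2 (?c (X i)))"
    by (simp add: sum_subtractf)
  finally show ?thesis .
qed

lemma tendsto_shannon_entropy_map:
  assumes fin: "finite (set_pmf p)" and sub: "\<And>m. set_pmf (q m) \<subseteq> set_pmf p"
    and lim: "\<And>x. ((\<lambda>m. pmf (q m) x) \<longlongrightarrow> pmf p x) F"
  shows "((\<lambda>m. shannon_entropy (map_pmf f (q m))) \<longlongrightarrow> shannon_entropy (map_pmf f p)) F"
proof -
  let ?S = "set_pmf p"
  have pmf_map_sum: "pmf (map_pmf f r) z = (\<Sum>x\<in>{x\<in>?S. f x = z}. pmf r x)" if "set_pmf r \<subseteq> ?S" for r z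
  proof -
    have "pmf (map_pmf f r) z = measure r (f -` {z} \<inter> set_pmf r)"
      by (simp add: pmf_map measure_Int_set_pmf)
    also have "\<dots> = measure r ({x\<in>?S. f x = z} \<inter> set_pmf r)"
      using that by (intro arg_cong[where f = "measure r"]) auto
    also have "\<dots> = (\<Sum>x\<in>{x\<in>?S. f x = z}. pmf r x)"
      using fin by (simp add: measure_Int_set_pmf measure_measure_pmf_finite)
    finally show ?thesis .
  qed
  have "((\<lambda>m. pmf (map_pmf f (q m)) z) \<longlongrightarrow> pmf (map_pmf f p) z) F" for z
    unfolding pmf_map_sum[OF sub] pmf_map_sum[OF subset_refl] by (intro tendsto_sum lim)
  \<comment> \<open>For \<open>z\<close> in \<open>f\<close> followed by the image of
    \<open>?S\<close>, the limit mass is positive, so \<open>log\<close> is continuous there and no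
    limit of the form 0 times log 0 arises.\<close>
  then have "((\<lambda>m. - (\<Sum>z\<in>f ` ?S. pmf (map_pmf f (q m)) z * log 2 (pmf (map_pmf f (q m)) z)))
      \<longlongrightarrow> - (\<Sum>z\<in>f ` ?S. pmf (map_pmf f p) z * log 2 (pmf (map_pmf f p) z))) F"
    by (intro tendsto_intros) (auto simp: pmf_eq_0_set_pmf)
  moreover have "set_pmf (map_pmf f (q m)) \<subseteq> f ` ?S" for m
    using sub by auto
  ultimately show ?thesis
    using fin by (simp add: shannon_entropy_superset[of "f ` ?S"])
qed

lemma exists_table:
  fixes k :: "'a \<Rightarrow> nat"
  assumes "finite S"
  shows "\<exists>X. X ` {..<\<Sum>x\<in>S. k x} \<subseteq> S \<and> (\<forall>x\<in>S. card {i. i < (\<Sum>x\<in>S. k x) \<and> X i = x} = k x)"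
proof -
  obtain xs where xs: "set xs = S" "distinct xs"
    using assms finite_distinct_list by blast
  \<comment> \<open>Each \<open>x\<close> is listed \<open>k x\<close> times; row \<open>i\<close>
    of the table is the entry at position \<open>i\<close>.\<close>
  let ?l = "concat (map (\<lambda>x. replicate (k x) x) xs)"
  have len: "length ?l = (\<Sum>x\<in>S. k x)"
    using xs by (auto simp: length_concat o_def sum_list_distinct_conv_sum_set)
  have "count_list ?l x = (if x \<in> S then k x else 0)" for x
  proof -
    have "count_list (concat (map (\<lambda>x. replicate (k x) x) ys)) x = (if x \<in> set ys then k x else 0)"
      if "distinct ys" for ys
      using that by (induction ys) (auto simp: count_list_eq_length_filter filter_replicate)
    then show ?thesis using xs by metis
  qed
  moreover have "card {i. i < length ?l \<and> ?l ! i = x} = count_list ?l x" for x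
    by (simp add: count_list_eq_length_filter length_filter_conv_card)
       (metis (no_types, lifting))
  moreover have "(!) ?l ` {..<length ?l} \<subseteq> S"
    using nth_mem[of _ ?l] xs(1) by fastforce
  ultimately show ?thesis
    unfolding len[symmetric] by (intro exI[of _ "(!) ?l"]) auto
qed

lemma tendsto_floor_Suc_div:
  assumes "a \<ge> 0"
  shows "(\<lambda>m. Suc (nat \<lfloor>real m * a\<rfloor>) / real m) \<longlonglongrightarrow> a"
proof (rule tendsto_sandwich)
  have bounds: "real m * a \<le> Suc (nat \<lfloor>real m * a\<rfloor>) \<and> Suc (nat \<lfloor>real m * a\<rfloor>) \<le> real m * a + 1" for m
    using assms by (simp add: of_nat_nat) linarith
  show "eventually (\<lambda>m. a \<le> Suc (nat \<lfloor>real m * a\<rfloor>) / real m) sequentially"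
    using eventually_gt_at_top[of 0]
    by eventually_elim (use bounds in \<open>simp add: le_divide_eq mult.commute\<close>)
  show "eventually (\<lambda>m. Suc (nat \<lfloor>real m * a\<rfloor>) / real m \<le> a + 1 / real m) sequentially"
    using eventually_gt_at_top[of 0]
    by eventually_elim (use bounds in \<open>simp add: field_simps\<close>)
  have "(\<lambda>m. a + 1 / real m) \<longlonglongrightarrow> a + 0"
    by (intro tendsto_add tendsto_const lim_1_over_n)
  then show "(\<lambda>m. a + 1 / real m) \<longlonglongrightarrow> a" by simp
qed (rule tendsto_const)

lemma table_pmf_dense:
  fixes p :: "'a pmf"
  assumes fin: "finite (set_pmf p)"
  obtains N X where "\<And>m. N m > 0" "\<And>m. X m ` {..<N m} \<subseteq> set_pmf p"
    "\<And>x. (\<lambda>m. pmf (map_pmf (X m) (pmf_of_set {..<N m :: nat})) x) \<longlonglongrightarrow> pmf p x"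
proof -
  let ?S = "set_pmf p"
  \<comment> \<open>About \<open>m * pmf p x\<close> rows carry the value \<open>x\<close>. The
    \<open>Suc\<close> keeps the table nonempty, even at \<open>m = 0\<close>, and changes the
    proportions by a vanishing amount.\<close>
  define k where "k m x = Suc (nat \<lfloor>real m * pmf p x\<rfloor>)" for m :: nat and x
  define N where "N m = (\<Sum>x\<in>?S. k m x)" for m
  have N: "N m > 0" for m
    using fin set_pmf_not_empty[of p] by (auto simp: N_def k_def sum_pos)
  have "\<forall>m. \<exists>X. X ` {..<N m} \<subseteq> ?S \<and> (\<forall>x\<in>?S. card {i. i < N m \<and> X i = x} = k m x)"
    using exists_table[OF fin] unfolding N_def by blast
  then obtain X where X: "\<And>m. X m ` {..<N m} \<subseteq> ?S"
    and card: "\<And>m x. x \<in> ?S \<Longrightarrow> card {i. i < N m \<and> X m i = x} = k m x"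
    by metis
  have "(\<lambda>m. pmf (map_pmf (X m) (pmf_of_set {..<N m})) x) \<longlonglongrightarrow> pmf p x" for x
  proof (cases "x \<in> ?S")
    case True
    \<comment> \<open>The row total \<open>N m\<close> need not equal \<open>m\<close>; dividing
      counts and total by \<open>m\<close> gives the limits \<open>pmf p x\<close> and 1.\<close>
    have "(\<lambda>m. (k m x / real m) / (\<Sum>y\<in>?S. k m y / real m)) \<longlonglongrightarrow> pmf p x / (\<Sum>y\<in>?S. pmf p y)"
      unfolding k_def
      by (intro tendsto_divide tendsto_sum tendsto_floor_Suc_div pmf_nonneg) (use fin in \<open>simp add: sum_pmf_eq_1\<close>)
    then have "(\<lambda>m. (k m x / real m) / (\<Sum>y\<in>?S. k m y / real m)) \<longlonglongrightarrow> pmf p x"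
      using fin by (simp add: sum_pmf_eq_1)
    moreover have "eventually (\<lambda>m. (k m x / real m) / (\<Sum>y\<in>?S. k m y / real m) =
        pmf (map_pmf (X m) (pmf_of_set {..<N m})) x) sequentially"
      using eventually_gt_at_top[of 0]
    proof eventually_elim
      case (elim m)
      have "pmf (map_pmf (X m) (pmf_of_set {..<N m})) x = k m x / N m"
        using N True by (simp add: pmf_map_table card)
      then show ?case using elim by (simp add: N_def flip: sum_divide_distrib)
    qed
    ultimately show ?thesis by (rule Lim_transform_eventually)
  next
    case False
    then have "pmf (map_pmf (X m) (pmf_of_set {..<N m})) x = 0" for m
      using X[of m] N[of m] by (auto simp: pmf_eq_0_set_pmf lessThan_empty_iff)
    then show ?thesis using False by (simp add: set_pmf_iff)
  qed
  with N X that show ?thesis by blast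
qed

lemma tendsto_dot:
  "(\<And>\<alpha>. ((\<lambda>m. h m \<alpha>) \<longlongrightarrow> h' \<alpha>) F) \<Longrightarrow> ((\<lambda>m. dot n c (h m)) \<longlongrightarrow> dot n c h') F"
  unfolding dot_def by (intro tendsto_intros)

lemma entropic_iff_table:
  "(\<exists>h\<in>entropic_vectors n. (\<forall>c'\<in>set cs. dot n c' h > 0) \<and> dot n c h < 0) \<longleftrightarrow>
   (\<exists>(N::nat) X. N > 0 \<and> X \<in> {..<N} \<rightarrow> extensional {..<n} \<and>
     (let h = entropic_vector n (map_pmf X (pmf_of_set {..<N}))
      in (\<forall>c'\<in>set cs. dot n c' h > 0) \<and> dot n c h < 0))"
proof (intro iffI; elim bexE exE conjE)
  fix h assume h: "h \<in> entropic_vectors n" "\<forall>c'\<in>set cs. dot n c' h > 0" "dot n c h < 0"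
  then obtain p D where p: "h = entropic_vector n p" "\<forall>i<n. finite (D i)"
    "set_pmf p \<subseteq> (\<Pi>\<^sub>E i\<in>{..<n}. D i)"
    unfolding entropic_vectors_def by blast
  have fin: "finite (set_pmf p)"
    by (rule finite_subset[OF p(3) finite_PiE]) (use p(2) in auto)
  obtain N X where X: "\<And>m. N m > 0" "\<And>m. X m ` {..<N m} \<subseteq> set_pmf p"
    and lim: "\<And>x. (\<lambda>m. pmf (map_pmf (X m) (pmf_of_set {..<N m :: nat})) x) \<longlonglongrightarrow> pmf p x"
    by (rule table_pmf_dense[OF fin]) blast
  let ?h = "\<lambda>m. entropic_vector n (map_pmf (X m) (pmf_of_set {..<N m}))"
  have sub: "set_pmf (map_pmf (X m) (pmf_of_set {..<N m})) \<subseteq> set_pmf p" for m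
    using X[of m] by (simp add: lessThan_empty_iff)
  have "(\<lambda>m. ?h m \<alpha>) \<longlonglongrightarrow> h \<alpha>" for \<alpha>
    using tendsto_shannon_entropy_map[OF fin sub lim, of "\<lambda>x. restrict x \<alpha>"]
    by (cases "\<alpha> \<subseteq> {..<n}") (simp_all add: p(1) entropic_vector_def)
  then have dot_lim: "(\<lambda>m. dot n c' (?h m)) \<longlonglongrightarrow> dot n c' h" for c'
    by (rule tendsto_dot)
  \<comment> \<open>Finitely many strict inequalities at the limit \<open>h\<close> persist for all
    large \<open>m\<close>.\<close>
  have "eventually (\<lambda>m. (\<forall>c'\<in>set cs. dot n c' (?h m) > 0) \<and> dot n c (?h m) < 0) sequentially"
    using h order_tendstoD[OF dot_lim] by (intro eventually_conj eventually_ball_finite) auto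
  then obtain m where "(\<forall>c'\<in>set cs. dot n c' (?h m) > 0) \<and> dot n c (?h m) < 0"
    by (auto simp: eventually_sequentially)
  moreover have "X m \<in> {..<N m} \<rightarrow> extensional {..<n}"
    using X(2)[of m] p(3) by (fastforce simp: PiE_def)
  ultimately show "\<exists>(N::nat) X. N > 0 \<and> X \<in> {..<N} \<rightarrow> extensional {..<n} \<and>
     (let h = entropic_vector n (map_pmf X (pmf_of_set {..<N}))
      in (\<forall>c'\<in>set cs. dot n c' h > 0) \<and> dot n c h < 0)"
    using X(1)[of m] unfolding Let_def by blast
next
  fix N :: nat and X assume X: "N > 0" "X \<in> {..<N} \<rightarrow> extensional {..<n}"
    and "let h = entropic_vector n (map_pmf X (pmf_of_set {..<N}))
      in (\<forall>c'\<in>set cs. dot n c' h > 0) \<and> dot n c h < 0"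
  moreover have "entropic_vector n (map_pmf X (pmf_of_set {..<N})) \<in> entropic_vectors n"
    unfolding entropic_vectors_def mem_Collect_eq
  \<comment> \<open>The finite domain of variable \<open>j\<close> is the set of entries in column
    \<open>j\<close>.\<close>
  proof (intro exI[of _ "map_pmf X (pmf_of_set {..<N})"] exI[of _ "\<lambda>j. (\<lambda>i. X i j) ` {..<N}"] conjI refl)
    have "set_pmf (map_pmf X (pmf_of_set {..<N})) = X ` {..<N}"
      using X(1) by (simp add: lessThan_empty_iff)
    then show "set_pmf (map_pmf X (pmf_of_set {..<N})) \<subseteq> (\<Pi>\<^sub>E j\<in>{..<n}. (\<lambda>i. X i j) ` {..<N})"
      using funcset_mem[OF X(2)] by (simp only: PiE_iff image_subset_iff) simp
  qed simp
  ultimately show "\<exists>h\<in>entropic_vectors n. (\<forall>c'\<in>set cs. dot n c' h > 0) \<and> dot n c h < 0"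
    unfolding Let_def by blast
qed

subsection \<open>Deciding the inequalities on finite tables\<close>

text \<open>A number \<open>w\<close> codes a table whose first \<open>N\<close> rows are joint values of the variables; the
  associated distribution picks one of these rows uniformly.\<close>

definition row :: "nat \<Rightarrow> nat \<Rightarrow> nat \<Rightarrow> nat \<Rightarrow> nat" where
  "row n w i = (\<lambda>j\<in>{..<n}. code_nth (code_nth w i) j)"

definition table_pmf :: "nat \<Rightarrow> nat \<Rightarrow> nat \<Rightarrow> (nat \<Rightarrow> nat) pmf" where
  "table_pmf n w N = map_pmf (row n w) (pmf_of_set {..<N})"

text \<open>For \<open>h\<close> the entropic vector of a table with \<open>N\<close> rows and \<open>\<alpha> = set_decode a\<close>, the entropy
  \<open>h \<alpha>\<close> satisfies \<open>N * h \<alpha> = log 2 (N ^ N / count_prod n w N a)\<close>.\<close>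

definition count_prod :: "nat \<Rightarrow> nat \<Rightarrow> nat \<Rightarrow> nat \<Rightarrow> nat" where
  "count_prod n w N a = (\<Prod>i<N. \<Sum>k<N.
     if \<forall>j<n. odd (a div 2 ^ j) \<longrightarrow> code_nth (code_nth w k) j = code_nth (code_nth w i) j then 1 else 0)"

text \<open>Positive and negative part of the integer with code \<open>z\<close>.\<close>

definition code_pos :: "nat \<Rightarrow> nat" where
  "code_pos z = (if odd z then 0 else z div 2)"

definition code_neg :: "nat \<Rightarrow> nat" where
  "code_neg z = (if odd z then Suc z div 2 else 0)"

text \<open>For \<open>N > 0\<close>, \<open>v\<close> the code of \<open>c\<close> and
  \<open>h\<close> the vector of the table, \<open>pos_side / neg_side\<close> is 2 to the power
  \<open>N * dot n c h\<close>. Factors with negative exponent are moved to the other side, so both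
  sides are natural numbers.\<close>

definition pos_side :: "nat \<Rightarrow> nat \<Rightarrow> nat \<Rightarrow> nat \<Rightarrow> nat" where
  "pos_side n w N v = (\<Prod>a<2 ^ n.
     (N ^ N) ^ code_pos (code_nth v a) * count_prod n w N a ^ code_neg (code_nth v a))"

definition neg_side :: "nat \<Rightarrow> nat \<Rightarrow> nat \<Rightarrow> nat \<Rightarrow> nat" where
  "neg_side n w N v = (\<Prod>a<2 ^ n.
     (N ^ N) ^ code_neg (code_nth v a) * count_prod n w N a ^ code_pos (code_nth v a))"

text \<open>The index 0 belongs to the conclusion \<open>c\<close>, the others to the antecedents.\<close>

definition refutes :: "nat \<Rightarrow> nat \<Rightarrow> nat \<Rightarrow> nat \<Rightarrow> bool" where
  "refutes n vs N w \<longleftrightarrow>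
     (\<forall>i<vs. 0 < i \<and> 0 < code_drop vs i \<longrightarrow> neg_side n w N (code_nth vs i) < pos_side n w N (code_nth vs i)) \<and>
     pos_side n w N (code_nth vs 0) < neg_side n w N (code_nth vs 0)"

section \<open>Computability of the refutation test\<close>

lemma rec_comp4:
  assumes "recursive_function 4 (\<lambda>xs. F (xs ! 0) (xs ! 1) (xs ! 2) (xs ! 3))"
    "recursive_function n f1" "recursive_function n f2" "recursive_function n f3" "recursive_function n f4"
  shows "recursive_function n (\<lambda>xs. F (f1 xs) (f2 xs) (f3 xs) (f4 xs))"
proof -
  have "recursive_function n (\<lambda>xs. (\<lambda>ys. F (ys ! 0) (ys ! 1) (ys ! 2) (ys ! 3)) (map (\<lambda>g. g xs) [f1, f2, f3, f4]))"
    by (rule recursive_function.comp) (use assms in \<open>auto simp: numeral_eq_Suc\<close>)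
  then show ?thesis by (simp add: numeral_eq_Suc)
qed

lemma rec_count_prod:
  "recursive_function 4 (\<lambda>xs. count_prod (xs ! 0) (xs ! 1) (xs ! 2) (xs ! 3))"
  unfolding count_prod_def by (intro rec_intros) simp_all

lemma rec_sides:
  "recursive_function 4 (\<lambda>xs. pos_side (xs ! 0) (xs ! 1) (xs ! 2) (xs ! 3))"
  "recursive_function 4 (\<lambda>xs. neg_side (xs ! 0) (xs ! 1) (xs ! 2) (xs ! 3))"
  unfolding pos_side_def neg_side_def code_pos_def code_neg_def
  by (intro rec_intros rec_comp4[OF rec_count_prod]; simp)+

lemma decidable_refutes:
  "decidable3 (\<lambda>x _ y. \<not> refutes (fst (prod_decode x)) (snd (prod_decode x))
     (Suc (fst (prod_decode y))) (snd (prod_decode y)))"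
proof -
  have "rec_pred 3 (\<lambda>xs. \<not> refutes (fst (prod_decode (xs ! 0))) (snd (prod_decode (xs ! 0)))
     (Suc (fst (prod_decode (xs ! 2)))) (snd (prod_decode (xs ! 2))))"
    unfolding refutes_def
    by (intro rec_intros rec_comp4[OF rec_sides(1)] rec_comp4[OF rec_sides(2)]) simp_all
  then show ?thesis by (simp add: rec_pred_def decidable3_def)
qed

section \<open>Signs of entropy expressions by comparing natural numbers\<close>

lemma code_pos_neg: "real_of_int c = real (code_pos (int_encode c)) - real (code_neg (int_encode c))"
  \<comment> \<open>\<open>int_encode\<close> sends \<open>c \<ge> 0\<close> to \<open>2 * c\<close>
    and \<open>c < 0\<close> to the odd number \<open>- 2 * c - 1\<close>, half of whose successor
    is \<open>- c\<close>.\<close>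
  by (cases "c \<ge> 0") (auto simp: code_pos_def code_neg_def int_encode_def sum_encode_def)

lemma bij_betw_set_decode: "bij_betw set_decode {..<2 ^ n} (Pow {..<n})"
proof (rule bij_betwI[where g = set_encode])
  show "set_decode \<in> {..<2 ^ n} \<rightarrow> Pow {..<n}"
  proof clarsimp
    fix a j :: nat assume "a < 2 ^ n" "j \<in> set_decode a"
    then have "2 ^ j < (2::nat) ^ n"
      by (metis (no_types, lifting) div_less even_zero mem_Collect_eq not_less order.strict_trans1 set_decode_def)
    then show "j < n" by simp
  qed
  show "set_encode \<in> Pow {..<n} \<rightarrow> {..<2 ^ n}"
  proof clarsimp
    fix A assume "A \<subseteq> {..<n}"
    then have "set_encode A \<le> (\<Sum>i<n. 2 ^ i)"
      unfolding set_encode_def by (intro sum_mono2) auto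
    also have "\<dots> < 2 ^ n"
      by (induction n) auto
    finally show "set_encode A < 2 ^ n" .
  qed
  show "set_encode (set_decode a) = a" for a by simp
  show "set_decode (set_encode A) = A" if "A \<in> Pow {..<n}" for A
    using that finite_subset[of A "{..<n}"] by simp
qed

lemma log_prod:
  fixes f :: "'a \<Rightarrow> real"
  assumes "\<And>i. i \<in> I \<Longrightarrow> f i > 0"
  shows "log b (\<Prod>i\<in>I. f i) = (\<Sum>i\<in>I. log b (f i))"
proof (cases "finite I")
  case True
  have "ln (\<Prod>i\<in>I. f i) = (\<Sum>i\<in>I. ln (f i))"
    by (rule ln_prod[OF True]) (use assms in force)
  then show ?thesis by (simp add: log_def sum_divide_distrib)
qed simp

text \<open>Row \<open>i\<close> agrees with itself, so every factor is at least 1.\<close>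

lemma count_prod_pos: "count_prod n w N a > 0"
  unfolding count_prod_def
proof (rule prod_pos)
  fix i assume "i \<in> {..<N}"
  then show "0 < (\<Sum>k<N. if \<forall>j<n. odd (a div 2 ^ j) \<longrightarrow>
      code_nth (code_nth w k) j = code_nth (code_nth w i) j then 1 else 0 :: nat)"
    by (intro sum_pos2[where i = i]) auto
qed

lemma dot_table:
  assumes "N > 0" "v = vector_code n c"
  shows "N * dot n (real_vector c) (entropic_vector n (table_pmf n w N)) =
    log 2 (pos_side n w N v) - log 2 (neg_side n w N v)"
proof -
  let ?P = "count_prod n w N" and ?M = "N ^ N"
  have pos: "?P a > 0" for a
    by (rule count_prod_pos)
  have ent: "N * entropic_vector n (table_pmf n w N) (set_decode a) = log 2 ?M - log 2 (?P a)"
    if a: "a < 2 ^ n" for a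
  proof -
    let ?X = "\<lambda>i. restrict (row n w i) (set_decode a)"
    have sub: "set_decode a \<subseteq> {..<n}"
      using bij_betw_apply[OF bij_betw_set_decode, of a n] a by simp
    \<comment> \<open>The set bits of \<open>a\<close> are the elements of the subset, so the inner
      sum of \<open>count_prod\<close> is the multiplicity of the sub-tuple in row
      \<open>i\<close>.\<close>
    have "?X k = ?X i \<longleftrightarrow> (\<forall>j<n. odd (a div 2 ^ j) \<longrightarrow> code_nth (code_nth w k) j = code_nth (code_nth w i) j)"
      for i k
      using sub by (auto simp: restrict_def row_def fun_eq_iff set_decode_def)
    then have "?P a = (\<Prod>i<N. card {k. k < N \<and> ?X k = ?X i})"
      unfolding count_prod_def card_eq_sum by (intro prod.cong refl sum.mono_neutral_cong_right) auto
    then have "log 2 (?P a) = (\<Sum>i<N. log 2 (card {k. k < N \<and> ?X k = ?X i}))"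
      by (simp only: of_nat_prod) (rule log_prod, auto simp: card_gt_0_iff)
    moreover have "entropic_vector n (table_pmf n w N) (set_decode a) =
        shannon_entropy (map_pmf ?X (pmf_of_set {..<N}))"
      using sub by (simp add: entropic_vector_def table_pmf_def map_pmf_comp)
    ultimately show ?thesis
      using shannon_entropy_table[OF assms(1), of ?X] assms(1) by (simp add: log_nat_power)
  qed
  have code: "code_nth v a = int_encode (c (set_decode a))" if "a < 2 ^ n" for a
    using that by (simp add: assms(2) vector_code_def code_nth_list_encode)
  have "N * dot n (real_vector c) (entropic_vector n (table_pmf n w N)) =
      (\<Sum>a<2 ^ n. c (set_decode a) * (N * entropic_vector n (table_pmf n w N) (set_decode a)))"
    unfolding dot_def real_vector_def sum.reindex_bij_betw[OF bij_betw_set_decode, symmetric]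
    by (simp add: sum_distrib_left mult.left_commute)
  also have "\<dots> = (\<Sum>a<2 ^ n. (real (code_pos (code_nth v a)) * log 2 ?M + real (code_neg (code_nth v a)) * log 2 (?P a))
      - (real (code_neg (code_nth v a)) * log 2 ?M + real (code_pos (code_nth v a)) * log 2 (?P a)))"
  proof (intro sum.cong refl)
    fix a :: nat assume "a \<in> {..<2 ^ n}"
    then have a: "a < 2 ^ n" by simp
    show "c (set_decode a) * (N * entropic_vector n (table_pmf n w N) (set_decode a)) =
      (real (code_pos (code_nth v a)) * log 2 ?M + real (code_neg (code_nth v a)) * log 2 (?P a))
      - (real (code_neg (code_nth v a)) * log 2 ?M + real (code_pos (code_nth v a)) * log 2 (?P a))"
      unfolding ent[OF a] code[OF a] code_pos_neg[of "c (set_decode a)"] by (simp only: algebra_simps)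
  qed
  also have "\<dots> = log 2 (pos_side n w N v) - log 2 (neg_side n w N v)"
  proof -
    \<comment> \<open>Stated for arbitrary exponents to cover both sides, which differ by exchanging
      positive and negative parts.\<close>
    have "log 2 (real (\<Prod>a<2 ^ n. ?M ^ f a * ?P a ^ g a)) =
        (\<Sum>a<2 ^ n. real (f a) * log 2 ?M + real (g a) * log 2 (?P a))" for f g :: "nat \<Rightarrow> nat"
    proof -
      have "log 2 (real (\<Prod>a<2 ^ n. ?M ^ f a * ?P a ^ g a)) =
          (\<Sum>a<2 ^ n. log 2 (real ?M ^ f a * real (?P a) ^ g a))"
        using assms(1) pos unfolding of_nat_prod by (subst log_prod) auto
      also have "\<dots> = (\<Sum>a<2 ^ n. real (f a) * log 2 ?M + real (g a) * log 2 (?P a))"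
      proof (intro sum.cong refl)
        fix a
        have "real ?M > 0" "real (?P a) > 0" using assms(1) pos by auto
        then show "log 2 (real ?M ^ f a * real (?P a) ^ g a) = real (f a) * log 2 ?M + real (g a) * log 2 (?P a)"
          by (subst log_mult_pos) (simp_all only: zero_less_power log_nat_power)
      qed
      finally show ?thesis .
    qed
    then show ?thesis unfolding pos_side_def neg_side_def sum_subtractf by simp
  qed
  finally show ?thesis .
qed

lemma sides_pos: "N > 0 \<Longrightarrow> pos_side n w N v > 0" "N > 0 \<Longrightarrow> neg_side n w N v > 0"
  unfolding pos_side_def neg_side_def by (auto intro!: prod_pos count_prod_pos)

text \<open>Multiplication by \<open>N > 0\<close> keeps the sign, and \<open>log 2\<close> is
  strictly increasing on positive numbers.\<close>

lemma dot_table_sign: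
  assumes "N > 0"
  shows "0 < dot n (real_vector c) (entropic_vector n (table_pmf n w N)) \<longleftrightarrow>
      neg_side n w N (vector_code n c) < pos_side n w N (vector_code n c)"
    and "dot n (real_vector c) (entropic_vector n (table_pmf n w N)) < 0 \<longleftrightarrow>
      pos_side n w N (vector_code n c) < neg_side n w N (vector_code n c)"
proof -
  let ?d = "dot n (real_vector c) (entropic_vector n (table_pmf n w N))"
  have "0 < ?d \<longleftrightarrow> 0 < N * ?d" "?d < 0 \<longleftrightarrow> N * ?d < 0"
    using assms by (auto simp: zero_less_mult_iff mult_less_0_iff)
  then show "0 < ?d \<longleftrightarrow> neg_side n w N (vector_code n c) < pos_side n w N (vector_code n c)"
    "?d < 0 \<longleftrightarrow> pos_side n w N (vector_code n c) < neg_side n w N (vector_code n c)"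
    using sides_pos[OF assms] by (simp_all add: dot_table[OF assms refl])
qed

section \<open>Correctness of the refutation test\<close>

lemma exists_row_code:
  assumes "X \<in> {..<N} \<rightarrow> extensional {..<n}"
  shows "\<exists>w. \<forall>i<N. row n w i = X i"
proof (intro exI allI impI)
  fix i assume i: "i < N"
  \<comment> \<open>The list of rows, each coded as the list of its first \<open>n\<close> entries;
    beyond these, extensionality forces agreement.\<close>
  let ?w = "list_encode (map (\<lambda>i. list_encode (map (X i) [0..<n])) [0..<N])"
  show "row n ?w i = X i"
  proof (rule extensionalityI[of _ "{..<n}"])
    show "X i \<in> extensional {..<n}" using assms i by auto
  qed (use i in \<open>auto simp: row_def code_nth_list_encode\<close>)
qed

lemma refutes_input:
  assumes "N > 0"
  shows "refutes n (list_encode (map (vector_code n) (c # cs))) N w \<longleftrightarrow>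
    (let h = entropic_vector n (table_pmf n w N)
     in (\<forall>c'\<in>set (map real_vector cs). dot n c' h > 0) \<and> dot n (real_vector c) h < 0)"
proof -
  let ?vs = "list_encode (map (vector_code n) (c # cs))"
  \<comment> \<open>The bound \<open>?vs\<close> is at least the list length and the
    \<open>code_drop\<close> guard cuts off at it, so \<open>i\<close> runs through exactly the
    positions of the antecedents.\<close>
  have all: "(\<forall>i<?vs. 0 < i \<and> 0 < code_drop ?vs i \<longrightarrow> P (code_nth ?vs i)) \<longleftrightarrow>
      (\<forall>c'\<in>set cs. P (vector_code n c'))" for P
  proof -
    have len: "0 < code_drop ?vs i \<longleftrightarrow> i < Suc (length cs)" for i
      using code_drop_list_encode_eq_0_iff[of "map (vector_code n) (c # cs)" i] by auto
    have "length (map (vector_code n) (c # cs)) \<le> ?vs"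
      by (rule length_le_list_encode)
    then have "i < Suc (length cs) \<Longrightarrow> i < ?vs" for i by simp
    then have "(\<forall>i<?vs. 0 < i \<and> 0 < code_drop ?vs i \<longrightarrow> P (code_nth ?vs i)) \<longleftrightarrow>
        (\<forall>i. 0 < i \<and> i < Suc (length cs) \<longrightarrow> P (map (vector_code n) (c # cs) ! i))"
      unfolding len by (metis code_nth_list_encode length_map length_Cons)
    also have "\<dots> \<longleftrightarrow> (\<forall>i<length cs. P (vector_code n (cs ! i)))"
    proof safe
      fix i assume *: "\<forall>i. 0 < i \<and> i < Suc (length cs) \<longrightarrow> P (map (vector_code n) (c # cs) ! i)"
        and "i < length cs"
      then show "P (vector_code n (cs ! i))" using *[rule_format, of "Suc i"] by simp
    next
      fix i assume "\<forall>i<length cs. P (vector_code n (cs ! i))" "0 < i" "i < Suc (length cs)"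
      then show "P (map (vector_code n) (c # cs) ! i)" by (cases i) simp_all
    qed
    also have "\<dots> \<longleftrightarrow> (\<forall>c'\<in>set cs. P (vector_code n c'))"
      by (simp add: all_set_conv_all_nth)
    finally show ?thesis .
  qed
  have hd: "code_nth ?vs 0 = vector_code n c"
    by (subst code_nth_list_encode) simp_all
  show ?thesis
    unfolding refutes_def Let_def hd all[of "\<lambda>v. neg_side n w N v < pos_side n w N v"]
    by (simp add: dot_table_sign[OF assms])
qed

lemma not_valid_iff_refutes:
  assumes "has_slack n (map real_vector cs)"
  shows "\<not> conditional_inequality_valid n (map real_vector cs) (real_vector c) \<longleftrightarrow>
    (\<exists>y. refutes n (list_encode (map (vector_code n) (c # cs)))
      (Suc (fst (prod_decode y))) (snd (prod_decode y)))"
    (is "_ \<longleftrightarrow> (\<exists>y. ?Q (Suc (fst (prod_decode y))) (snd (prod_decode y)))")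
proof -
  let ?cond = "\<lambda>p. let h = entropic_vector n p
     in (\<forall>c'\<in>set (map real_vector cs). dot n c' h > 0) \<and> dot n (real_vector c) h < 0"
  have "\<not> conditional_inequality_valid n (map real_vector cs) (real_vector c) \<longleftrightarrow>
      (\<exists>(N::nat) X. N > 0 \<and> X \<in> {..<N} \<rightarrow> extensional {..<n} \<and> ?cond (map_pmf X (pmf_of_set {..<N})))"
    unfolding not_valid_iff_entropic[OF assms] by (rule entropic_iff_table)
  also have "\<dots> \<longleftrightarrow> (\<exists>N w. N > 0 \<and> ?cond (table_pmf n w N))"
  proof (intro iffI; elim exE conjE)
    fix N :: nat and X assume X: "N > 0" "X \<in> {..<N} \<rightarrow> extensional {..<n}" "?cond (map_pmf X (pmf_of_set {..<N}))"
    obtain w where "\<forall>i<N. row n w i = X i"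
      using exists_row_code[OF X(2)] by blast
    then have "table_pmf n w N = map_pmf X (pmf_of_set {..<N})"
      unfolding table_pmf_def using X(1) by (intro map_pmf_cong refl) (auto simp: lessThan_empty_iff)
    with X show "\<exists>N w. N > 0 \<and> ?cond (table_pmf n w N)" by metis
  next
    fix N w assume "N > 0" "?cond (table_pmf n w N)"
    moreover have "row n w \<in> {..<N} \<rightarrow> extensional {..<n}" by (auto simp: row_def)
    ultimately show "\<exists>(N::nat) X. N > 0 \<and> X \<in> {..<N} \<rightarrow> extensional {..<n} \<and> ?cond (map_pmf X (pmf_of_set {..<N}))"
      unfolding table_pmf_def by blast
  qed
  also have "\<dots> \<longleftrightarrow> (\<exists>N w. N > 0 \<and> ?Q N w)"
    by (intro ex_cong1 conj_cong refl) (simp only: refutes_input)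
  also have "\<dots> \<longleftrightarrow> (\<exists>y. ?Q (Suc (fst (prod_decode y))) (snd (prod_decode y)))"
  proof (intro iffI; elim exE conjE)
    fix N w assume "N > 0" "?Q N w"
    then show "\<exists>y. ?Q (Suc (fst (prod_decode y))) (snd (prod_decode y))"
      \<comment> \<open>One number \<open>y\<close> codes row count and table together. It stores
        \<open>N - 1\<close>, because decoding applies \<open>Suc\<close> to exclude the empty
        table.\<close>
      by (intro exI[of _ "prod_encode (N - 1, w)"]) (simp only: prod_encode_inverse fst_conv snd_conv Suc_pred' [symmetric])
  qed blast
  finally show ?thesis .
qed

theorem corollary14:
  shows "\<exists>S\<in>Sigma02. \<forall>(n::nat) (c::nat set \<Rightarrow> int) (cs::(nat set \<Rightarrow> int) list).
           has_slack n (map real_vector cs) \<longrightarrow>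
           group_balanced n (map real_vector (c # map (\<lambda>c' \<alpha>. - c' \<alpha>) cs)) \<longrightarrow>
           (input_code n cs c \<in> S \<longleftrightarrow>
              conditional_inequality_valid n (map real_vector cs) (real_vector c))"
proof -
  \<comment> \<open>As \<open>y\<close> ranges over all numbers, every nonempty finite table is
    tested; \<open>x\<close> belongs to \<open>?S\<close> when none of them is a
    counterexample.\<close>
  let ?R = "\<lambda>x (_::nat) y. \<not> refutes (fst (prod_decode x)) (snd (prod_decode x))
     (Suc (fst (prod_decode y))) (snd (prod_decode y))"
  let ?S = "{x. \<exists>y1. \<forall>y2. ?R x y1 y2}"
  have "?S \<in> Sigma02"
    unfolding Sigma02_def mem_Collect_eq by (intro exI[of _ ?R] conjI refl decidable_refutes)
  moreover have "input_code n cs c \<in> ?S \<longleftrightarrow>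
      conditional_inequality_valid n (map real_vector cs) (real_vector c)"
    if "has_slack n (map real_vector cs)" for n c cs
  proof -
    have "input_code n cs c \<in> ?S \<longleftrightarrow> \<not> (\<exists>y. refutes n (list_encode (map (vector_code n) (c # cs)))
        (Suc (fst (prod_decode y))) (snd (prod_decode y)))"
      unfolding input_code_def mem_Collect_eq prod_encode_inverse fst_conv snd_conv by simp
    then show ?thesis
      unfolding not_valid_iff_refutes[OF that, of c, symmetric] by simp
  qed
  ultimately show ?thesis by (intro bexI[of _ ?S] allI impI)
qed

end
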